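(* For every $b\in(0,1]$ there is a constant $c_b>0$ depending only on $b$ such that the following holds. Let $\mu$ be a probability distribution supported on $\Omega=\{\pm1\}^n$ and $\{q_i:\Omega\to\mathbb{R}_+\}_{i\in[n]}$ be transition rates reversible for $\mu$. Assume that $0$-CSGE holds with constant $\rho_{\mathrm{CSGE}}\in\mathbb{R}$ and that the log-Sobolev inequality holds with constant $\rho_{\mathrm{LSI}}>0$, for a collection of weight functions $\{w_i:\Omega\to\mathbb{R}_+\}_{i\in[n]}$, and that both $\{q_i\}_{i\in[n]}$ and $\{w_i\}_{i\in[n]}$ are $b$-bounded. Let $\kappa_0=\max\{-\rho_{\mathrm{CSGE}},0\}$. Then for any $f:\Omega\to\{\pm1\}$, with $\mathcal M_w(f)=\max_{i\in[n]}I_{w,i}(f)$, $$I_w(f)\ge c_b\,\frac{\rho_{\mathrm{LSI}}^2}{\rho_{\mathrm{LSI}}+\kappa_0}\,\log(1/\mathcal M_w(f))\,\mathrm{Var}_\mu(f),$$ and hence $$\mathcal M_w(f)\ge c_b\,\frac{\rho_{\mathrm{LSI}}^2}{(\rho_{\mathrm{LSI}}+\kappa_0)n}\,\log\left(\frac{(\rho_{\mathrm{LSI}}+\kappa_0)n}{\rho_{\mathrm{LSI}}^2}\right)\mathrm{Var}_\mu(f).$$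
   Context: $x^i$ is $x\in\Omega$ with the $i$-th coordinate flipped. Generator: $Lf(x)=\sum_{i=1}^nq_i(x)(f(x^i)-f(x))$; $P_t=e^{tL}$. Reversible for $\mu$: $\mu(x)q_i(x)=\mu(x^i)q_i(x^i)$ for all $x,i$. A family $\{g_i\}$ of functions on $\Omega$ is $b$-bounded if $b\le g_i(x)\le1/b$ for all $x,i$. $\delta_{w,i}f(x)=\sqrt{\frac12w_i(x)q_i(x)}\,(f(x^i)-f(x))$; $\nabla_wf=(\delta_{w,1}f,\dots,\delta_{w,n}f)$; $|\nabla_w|f=(|\delta_{w,1}f|,\dots,|\delta_{w,n}f|)$. $I_{w,i}(f)=\mathbb{E}_\mu[(\delta_{w,i}f)^2]$; $I_w(f)=\sum_iI_{w,i}(f)$. $\Gamma(f)(x)=\frac12\sum_iq_i(x)(f(x^i)-f(x))^2$. $0$-CSGE with constant $\rho$: for all $f:\Omega\to\mathbb{R}$ and $t\ge0$, pointwise, $\|\nabla_wP_tf\|_2\le e^{-\rho t}\|P_t|\nabla_w|f\|_2$, where $P_t$ acts entrywise on vector fields. Log-Sobolev inequality with constant $\rho$: $\mathrm{Ent}_\mu[f^2]\le\frac2\rho\mathbb{E}_\mu[\Gamma(f)]$ for all $f:\Omega\to\mathbb{R}$, where $\mathrm{Ent}_\mu[g]=\mathbb{E}_\mu[g\log g]-\mathbb{E}_\mu[g]\log\mathbb{E}_\mu[g]$. $\log$ is natural. Right-hand sides are $0$ when $\mathrm{Var}_\mu(f)=0$. *)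

theory Defs
  imports "HOL-Probability.Probability"
begin

text \<open>
  Points of the discrete cube are extensional functions on \<open>{1..n}\<close>. The dimension is a natural
  number and not a type, since the constant in the theorem must not depend on it. Functions on the
  cube are total functions on \<open>point\<close>; their values outside \<open>cube n\<close> never matter.
\<close>

type_synonym point = "nat \<Rightarrow> int"

definition cube :: "nat \<Rightarrow> point set"
  where "cube n = {1..n} \<rightarrow>\<^sub>E {-1, 1}"

definition flip :: "nat \<Rightarrow> point \<Rightarrow> point"
  where "flip i x = x(i := - x i)"

definition nonneg_family :: "nat \<Rightarrow> (nat \<Rightarrow> point \<Rightarrow> real) \<Rightarrow> bool"
  where "nonneg_family n g \<longleftrightarrow> (\<forall>i\<in>{1..n}. \<forall>x\<in>cube n. 0 \<le> g i x)"

definition bounded_family :: "nat \<Rightarrow> real \<Rightarrow> (nat \<Rightarrow> point \<Rightarrow> real) \<Rightarrow> bool"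
  where "bounded_family n b g \<longleftrightarrow> (\<forall>i\<in>{1..n}. \<forall>x\<in>cube n. b \<le> g i x \<and> g i x \<le> 1 / b)"

definition reversible :: "nat \<Rightarrow> point pmf \<Rightarrow> (nat \<Rightarrow> point \<Rightarrow> real) \<Rightarrow> bool"
  where "reversible n \<mu> q \<longleftrightarrow>
    (\<forall>i\<in>{1..n}. \<forall>x\<in>cube n. pmf \<mu> x * q i x = pmf \<mu> (flip i x) * q i (flip i x))"

definition generator :: "nat \<Rightarrow> (nat \<Rightarrow> point \<Rightarrow> real) \<Rightarrow> (point \<Rightarrow> real) \<Rightarrow> point \<Rightarrow> real"
  where "generator n q f x = (\<Sum>i=1..n. q i x * (f (flip i x) - f x))"

text \<open>
  The operator exponential \<open>exp (t L)\<close>, as a pointwise power series. It converges at every point of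
  the cube, see \<open>summable_semigroup\<close> below.
\<close>

definition semigroup ::
    "nat \<Rightarrow> (nat \<Rightarrow> point \<Rightarrow> real) \<Rightarrow> real \<Rightarrow> (point \<Rightarrow> real) \<Rightarrow> point \<Rightarrow> real"
  where "semigroup n q t f x = (\<Sum>k. t ^ k / fact k * (generator n q ^^ k) f x)"

definition wderiv ::
    "(nat \<Rightarrow> point \<Rightarrow> real) \<Rightarrow> (nat \<Rightarrow> point \<Rightarrow> real) \<Rightarrow> nat \<Rightarrow> (point \<Rightarrow> real) \<Rightarrow> point \<Rightarrow> real"
  where "wderiv q w i f x = sqrt (1 / 2 * w i x * q i x) * (f (flip i x) - f x)"

definition influence ::
    "point pmf \<Rightarrow> (nat \<Rightarrow> point \<Rightarrow> real) \<Rightarrow> (nat \<Rightarrow> point \<Rightarrow> real) \<Rightarrow> nat \<Rightarrow> (point \<Rightarrow> real) \<Rightarrow> real"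
  where "influence \<mu> q w i f = measure_pmf.expectation \<mu> (\<lambda>x. (wderiv q w i f x)\<^sup>2)"

definition total_influence ::
    "nat \<Rightarrow> point pmf \<Rightarrow> (nat \<Rightarrow> point \<Rightarrow> real) \<Rightarrow> (nat \<Rightarrow> point \<Rightarrow> real) \<Rightarrow> (point \<Rightarrow> real) \<Rightarrow> real"
  where "total_influence n \<mu> q w f = (\<Sum>i=1..n. influence \<mu> q w i f)"

definition max_influence ::
    "nat \<Rightarrow> point pmf \<Rightarrow> (nat \<Rightarrow> point \<Rightarrow> real) \<Rightarrow> (nat \<Rightarrow> point \<Rightarrow> real) \<Rightarrow> (point \<Rightarrow> real) \<Rightarrow> real"
  where "max_influence n \<mu> q w f = Max ((\<lambda>i. influence \<mu> q w i f) ` {1..n})"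

definition carre_du_champ ::
    "nat \<Rightarrow> (nat \<Rightarrow> point \<Rightarrow> real) \<Rightarrow> (point \<Rightarrow> real) \<Rightarrow> point \<Rightarrow> real"
  where "carre_du_champ n q f x = 1 / 2 * (\<Sum>i=1..n. q i x * (f (flip i x) - f x)\<^sup>2)"

text \<open>The convention \<open>0 log 0 = 0\<close> is built into \<open>ln 0 = 0\<close>.\<close>

definition Ent :: "point pmf \<Rightarrow> (point \<Rightarrow> real) \<Rightarrow> real"
  where "Ent \<mu> g = measure_pmf.expectation \<mu> (\<lambda>x. g x * ln (g x))
    - measure_pmf.expectation \<mu> g * ln (measure_pmf.expectation \<mu> g)"

definition zero_CSGE ::
    "nat \<Rightarrow> (nat \<Rightarrow> point \<Rightarrow> real) \<Rightarrow> (nat \<Rightarrow> point \<Rightarrow> real) \<Rightarrow> real \<Rightarrow> bool"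
  where "zero_CSGE n q w \<rho> \<longleftrightarrow>
    (\<forall>f. \<forall>t\<ge>0. \<forall>x\<in>cube n.
      L2_set (\<lambda>i. wderiv q w i (semigroup n q t f) x) {1..n}
      \<le> exp (- \<rho> * t) * L2_set (\<lambda>i. semigroup n q t (\<lambda>y. \<bar>wderiv q w i f y\<bar>) x) {1..n})"

definition log_Sobolev :: "nat \<Rightarrow> point pmf \<Rightarrow> (nat \<Rightarrow> point \<Rightarrow> real) \<Rightarrow> real \<Rightarrow> bool"
  where "log_Sobolev n \<mu> q \<rho> \<longleftrightarrow>
    (\<forall>f. Ent \<mu> (\<lambda>x. (f x)\<^sup>2) \<le> 2 / \<rho> * measure_pmf.expectation \<mu> (carre_du_champ n q f))"

lemma flip_in_cube: "i \<in> {1..n} \<Longrightarrow> x \<in> cube n \<Longrightarrow> flip i x \<in> cube n"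
  unfolding cube_def flip_def by (fastforce simp: PiE_iff extensional_def)

lemma finite_cube: "finite (cube n)"
  unfolding cube_def by (intro finite_PiE) auto

lemma summable_semigroup:
  assumes x: "x \<in> cube n"
  shows "summable (\<lambda>k. t ^ k / fact k * (generator n q ^^ k) f x)"
proof -
  let ?S = "(\<lambda>(i, y). \<bar>q i y\<bar>) ` ({1..n} \<times> cube n)"
  let ?T = "(\<lambda>y. \<bar>f y\<bar>) ` cube n"
  define B where "B = Max (insert 0 ?S)"
  define M where "M = Max (insert 0 ?T)"
  have q: "\<bar>q i y\<bar> \<le> B" if "i \<in> {1..n}" "y \<in> cube n" for i y
    unfolding B_def using that finite_cube by (intro Max_ge) auto
  have f: "\<bar>f y\<bar> \<le> M" if "y \<in> cube n" for y
    unfolding M_def using that finite_cube by (intro Max_ge) auto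
  have B0: "0 \<le> B" unfolding B_def using finite_cube by (intro Max_ge) auto
  define C where "C = real n * (B * 2)"
  have bound: "\<bar>(generator n q ^^ k) f y\<bar> \<le> C ^ k * M" if "y \<in> cube n" for k y
    using that
  proof (induction k arbitrary: y)
    case 0
    then show ?case using f by simp
  next
    case (Suc k)
    let ?g = "(generator n q ^^ k) f"
    have "\<bar>generator n q ?g y\<bar> \<le> (\<Sum>i=1..n. \<bar>q i y * (?g (flip i y) - ?g y)\<bar>)"
      unfolding generator_def by (rule sum_abs)
    also have "\<dots> \<le> (\<Sum>i=1..n. B * (2 * (C ^ k * M)))"
    proof (rule sum_mono)
      fix i assume i: "i \<in> {1..n}"
      have "\<bar>?g (flip i y) - ?g y\<bar> \<le> 2 * (C ^ k * M)"
        using Suc.IH[OF flip_in_cube[OF i Suc.prems]] Suc.IH[OF Suc.prems] by linarith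
      then show "\<bar>q i y * (?g (flip i y) - ?g y)\<bar> \<le> B * (2 * (C ^ k * M))"
        unfolding abs_mult using q[OF i Suc.prems] B0 by (intro mult_mono) auto
    qed
    also have "\<dots> = C ^ Suc k * M" by (simp add: C_def)
    finally show ?case by simp
  qed
  show ?thesis
  proof (rule summable_comparison_test')
    show "summable (\<lambda>k. inverse (fact k) * (\<bar>t\<bar> * C) ^ k * M)"
      by (intro summable_mult2 summable_exp)
    fix k :: nat
    have "norm (t ^ k / fact k * (generator n q ^^ k) f x)
        = \<bar>t\<bar> ^ k / fact k * \<bar>(generator n q ^^ k) f x\<bar>"
      by (simp add: abs_mult power_abs)
    also have "\<dots> \<le> \<bar>t\<bar> ^ k / fact k * (C ^ k * M)"
      by (intro mult_left_mono bound x) simp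
    finally show "norm (t ^ k / fact k * (generator n q ^^ k) f x)
        \<le> inverse (fact k) * (\<bar>t\<bar> * C) ^ k * M"
      by (simp add: power_mult_distrib field_simps)
  qed
qed

end

theory Submission
  imports Defs
begin

text \<open>
  The proof follows Talagrand's inequality in its semigroup form. Write \<open>P t\<close> for the semigroup,
  \<open>E\<close> for the mean under \<open>\<mu>\<close>, \<open>I\<close> and \<open>M\<close> for the total and the maximal influence of \<open>f\<close>, and
  \<open>\<rho>\<close> for the log-Sobolev constant; \<open>\<kappa> \<ge> 0\<close> measures the negative part of the curvature, and the
  interesting case is \<open>M < 1\<close>. The second moment \<open>E (P t f)\<^sup>2\<close> has derivative
  \<open>- 2 E (\<Gamma> (P t f))\<close>, where \<open>\<Gamma>\<close> is the carre du champ, and over the time interval up to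
  \<open>T = 1 / (\<rho> + \<kappa>)\<close> its decrease is estimated from both sides.

  From below, the log-Sobolev inequality implies a Poincare inequality, and so a part of the variance
  of order \<open>\<rho> * T\<close> is lost (lemma \<open>semigroup_power2_loss\<close>).

  From above, the curvature condition compares \<open>E (\<Gamma> (P t f))\<close> with the second moments of
  \<open>P t g\<close>, where \<open>g\<close> runs over the absolute partial derivatives of \<open>f\<close>; before time \<open>T\<close> the
  negative curvature costs only a constant factor. Because \<open>f\<close> is Boolean, such a \<open>g\<close> is either \<open>0\<close>
  or bounded away from \<open>0\<close>. A function like this with a small second moment has a mean of the same
  small order, so that its second moment must shrink from \<open>I\<^sub>i\<close> towards order \<open>I\<^sub>i\<^sup>2\<close>. Its speed
  is controlled by the log-Sobolev inequality (lemmas \<open>ln_semigroup_power2_decay\<close> and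
  \<open>semigroup_power2_gap_decay\<close>): up to constants, the second moment at time \<open>t\<close> is at most
  \<open>I\<^sub>i * exp (- ln (1 / M) * \<rho> * t / 2)\<close>. Summing over the coordinates and integrating over time
  bounds the loss by a multiple of \<open>I / (\<rho> * ln (1 / M))\<close>.

  Comparing the two estimates gives the bound on \<open>I\<close> (lemma \<open>Talagrand_influence_bound\<close>). The bound
  on \<open>M\<close> follows from \<open>I \<le> n * M\<close> by distinguishing whether \<open>M\<close> lies below or above the square root
  of \<open>\<rho>\<^sup>2 / ((\<rho> + \<kappa>) * n)\<close> (lemma \<open>bootstrap_max_influence\<close>).

  The usual tool for the second moments of \<open>P t g\<close> is hypercontractivity. Here the elementary bound
  \<open>E h\<^sup>2 * ln (E h\<^sup>2 / (E h)\<^sup>2) \<le> Ent (h\<^sup>2)\<close> for nonnegative \<open>h\<close> (lemma \<open>Ent_power2_ge\<close>) takes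
  its place: the semigroup preserves the mean, so the log-Sobolev inequality becomes an ordinary
  differential inequality for the second moment alone. The same bound yields the Poincare inequality.
\<close>

section \<open>Real inequalities\<close>

text \<open>
  The negative part itself has a kink at \<open>0\<close>. Its square does not, which is why positivity of the
  semigroup is read off from the squared negative part.
\<close>

lemma DERIV_min_0_power2:
  "((\<lambda>y::real. (min y 0)\<^sup>2) has_real_derivative 2 * min y 0) (at y)"
proof -
  consider "y < 0" | "y > 0" | "y = 0" by linarith
  then show ?thesis
  proof cases
    case 1
    have "((\<lambda>y::real. y\<^sup>2) has_real_derivative 2 * y) (at y)"
      by (auto intro!: derivative_eq_intros)
    moreover have "eventually (\<lambda>z. z\<^sup>2 = (min z 0)\<^sup>2) (nhds y)"
      by (intro eventually_mono[OF eventually_nhds_in_open[of "{..<0}" y]]) (use 1 in auto)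
    ultimately show ?thesis
      using 1 DERIV_cong_ev[OF refl _ refl, of "\<lambda>z. z\<^sup>2" "\<lambda>z. (min z 0)\<^sup>2" y] by simp
  next
    case 2
    have "eventually (\<lambda>z. 0 = (min z 0)\<^sup>2) (nhds y)"
      by (intro eventually_mono[OF eventually_nhds_in_open[of "{0<..}" y]]) (use 2 in auto)
    then show ?thesis
      using 2 DERIV_cong_ev[OF refl _ refl, of "\<lambda>z. 0" "\<lambda>z. (min z 0)\<^sup>2" y 0] by simp
  next
    case 3
    have "((\<lambda>h::real. (min h 0)\<^sup>2 / h) \<longlongrightarrow> 0) (at 0)"
    proof (rule Lim_null_comparison)
      show "\<forall>\<^sub>F h in at 0. norm ((min h 0)\<^sup>2 / h) \<le> \<bar>h::real\<bar>"
        by (rule always_eventually) (auto simp: min_def power2_eq_square)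
      show "((\<lambda>h::real. \<bar>h\<bar>) \<longlongrightarrow> 0) (at 0)"
        by (intro tendsto_eq_intros) auto
    qed
    then show ?thesis using 3 by (simp add: DERIV_def)
  qed
qed

lemma one_minus_exp_ge_half:
  assumes "0 \<le> x" "x \<le> (1::real)"
  shows "x / 2 \<le> 1 - exp (- x)"
proof -
  have "exp (- x) \<le> 1 / (1 + x)"
    using exp_ge_add_one_self[of x] assms by (simp add: exp_minus field_simps)
  also have "\<dots> \<le> 1 - x / 2"
    using assms mult_left_mono[of x 1 x] by (simp add: field_simps)
  finally show ?thesis by simp
qed

lemma mult_ln_inverse_le_sqrt:
  assumes "0 < (s::real)"
  shows "s * ln (1 / s) \<le> sqrt s * 2"
proof -
  have "ln (1 / sqrt s) \<le> 1 / sqrt s - 1" using assms by (intro ln_le_minus_one) auto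
  then have "ln (1 / s) \<le> 2 / sqrt s"
    using assms by (simp add: ln_div ln_sqrt)
  then have "s * ln (1 / s) \<le> s * (2 / sqrt s)" using assms by (intro mult_left_mono) auto
  also have "\<dots> = sqrt s * 2" using assms using real_div_sqrt[of s] assms by (simp add: field_simps)
  finally show ?thesis .
qed

text \<open>
  This removes \<open>M\<close> from the logarithm. Below the threshold \<open>sqrt s\<close>, \<open>ln (1 / M)\<close> is at least half of
  \<open>ln (1 / s)\<close>; above it, \<open>M\<close> already dominates \<open>s * ln (1 / s)\<close> up to a factor \<open>2\<close>.
\<close>

lemma bootstrap_max_influence:
  assumes c: "0 < c" "c \<le> 1" and s: "0 < s" and V: "0 \<le> V" "V \<le> 1" and M: "0 < M"
    and bound: "c * s * ln (1 / M) * V \<le> M"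
  shows "c / 2 * s * ln (1 / s) * V \<le> (M::real)"
proof (cases "M \<le> sqrt s")
  case True
  have "ln (1 / s) / 2 = ln (1 / sqrt s)" using s by (simp add: ln_div ln_sqrt)
  also have "\<dots> \<le> ln (1 / M)"
    using True M s by (simp add: ln_div)
  finally have "c * s * V * (ln (1 / s) / 2) \<le> c * s * V * ln (1 / M)"
    using c s V by (intro mult_left_mono) auto
  then show ?thesis using bound by (simp add: mult_ac)
next
  case False
  have "c * V * (s * ln (1 / s) / 2) \<le> c * V * sqrt s"
    using mult_ln_inverse_le_sqrt[OF s] c V by (intro mult_left_mono) auto
  also have "\<dots> \<le> 1 * sqrt s"
    using c V s mult_mono[of c 1 V 1] by (intro mult_right_mono) auto
  finally show ?thesis using False by (simp add: mult_ac)
qed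

section \<open>The generator and its semigroup\<close>

lemma semigroup_0: "semigroup n q 0 f = f"
proof
  fix x
  have "semigroup n q 0 f x = (\<Sum>k. (generator n q ^^ k) f x / fact k * 0 ^ k)"
    unfolding semigroup_def by (intro suminf_cong) simp
  also have "\<dots> = f x"
    by (subst powser_zero) simp
  finally show "semigroup n q 0 f x = f x" .
qed

text \<open>
  The generator evaluates a function at only finitely many points, so it may be applied to the
  exponential series term by term.
\<close>

lemma generator_semigroup:
  assumes x: "x \<in> cube n"
  shows "generator n q (semigroup n q t f) x
    = (\<Sum>k. t ^ k / fact k * generator n q ((generator n q ^^ k) f) x)"
proof -
  let ?g = "\<lambda>k. (generator n q ^^ k) f"
  have S: "summable (\<lambda>k. t ^ k / fact k * ?g k y)" if "y \<in> cube n" for y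
    using summable_semigroup[OF that] .
  have flip: "flip i x \<in> cube n" if "i \<in> {1..n}" for i
    using flip_in_cube[OF that x] .
  have "generator n q (semigroup n q t f) x
      = (\<Sum>i=1..n. q i x * (\<Sum>k. t ^ k / fact k * ?g k (flip i x) - t ^ k / fact k * ?g k x))"
    unfolding generator_def[of n q "semigroup n q t f"] semigroup_def
    by (intro sum.cong refl arg_cong2[of _ _ _ _ "(*)"] suminf_diff S flip x)
  also have "\<dots> = (\<Sum>i=1..n. \<Sum>k. q i x * (t ^ k / fact k * ?g k (flip i x) - t ^ k / fact k * ?g k x))"
    by (intro sum.cong refl suminf_mult[symmetric] summable_diff S flip x)
  also have "\<dots> = (\<Sum>k. \<Sum>i=1..n. q i x * (t ^ k / fact k * ?g k (flip i x) - t ^ k / fact k * ?g k x))"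
    by (intro suminf_sum[symmetric] summable_mult summable_diff S flip x)
  also have "\<dots> = (\<Sum>k. t ^ k / fact k * generator n q (?g k) x)"
    unfolding generator_def[of n q "(generator n q ^^ _) f"] sum_distrib_left
    by (intro suminf_cong sum.cong refl) (simp add: algebra_simps)
  finally show ?thesis .
qed

lemma semigroup_has_derivative:
  assumes x: "x \<in> cube n"
  shows "((\<lambda>t. semigroup n q t f x) has_real_derivative generator n q (semigroup n q t f) x) (at t)"
proof -
  let ?c = "\<lambda>k. (generator n q ^^ k) f x / fact k"
  have "summable (\<lambda>k. ?c k * y ^ k)" for y
    using summable_semigroup[OF x, of y q f] by (simp add: field_simps)
  then have "((\<lambda>t. \<Sum>k. ?c k * t ^ k) has_real_derivative (\<Sum>k. diffs ?c k * t ^ k)) (at t)"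
    by (rule termdiffs_strong_converges_everywhere)
  moreover have "(\<lambda>t. \<Sum>k. ?c k * t ^ k) = (\<lambda>t. semigroup n q t f x)"
    unfolding semigroup_def by (intro ext suminf_cong) simp
  moreover have "(\<Sum>k. diffs ?c k * t ^ k) = generator n q (semigroup n q t f) x"
    unfolding generator_semigroup[OF x] by (intro suminf_cong) (simp add: diffs_def del: of_nat_Suc)
  ultimately show ?thesis by simp
qed

section \<open>Reversible chains on the cube\<close>

locale reversible_chain =
  fixes n :: nat and \<mu> :: "point pmf" and q :: "nat \<Rightarrow> point \<Rightarrow> real"
  assumes supp: "set_pmf \<mu> \<subseteq> cube n"
    and rates_nonneg: "nonneg_family n q"
    and rev: "reversible n \<mu> q"
begin

abbreviation E :: "(point \<Rightarrow> real) \<Rightarrow> real"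
  where "E f \<equiv> measure_pmf.expectation \<mu> f"

abbreviation P :: "real \<Rightarrow> (point \<Rightarrow> real) \<Rightarrow> point \<Rightarrow> real"
  where "P \<equiv> semigroup n q"

abbreviation D :: "nat \<Rightarrow> (point \<Rightarrow> real) \<Rightarrow> point \<Rightarrow> real"
  where "D i f x \<equiv> f (flip i x) - f x"

lemma q_nonneg: "i \<in> {1..n} \<Longrightarrow> x \<in> cube n \<Longrightarrow> 0 \<le> q i x"
  using rates_nonneg by (simp add: nonneg_family_def)

lemma integrable_E [simp, intro]: "integrable (measure_pmf \<mu>) (f :: point \<Rightarrow> real)"
  by (rule integrable_measure_pmf_finite) (rule finite_subset[OF supp finite_cube])

lemma E_eq_sum: "E f = (\<Sum>x\<in>cube n. pmf \<mu> x * f x)"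
  using supp by (subst integral_measure_pmf[OF finite_cube]) auto

lemma E_mono: "(\<And>x. x \<in> cube n \<Longrightarrow> f x \<le> g x) \<Longrightarrow> E f \<le> E g"
  unfolding E_eq_sum by (intro sum_mono mult_left_mono) auto

lemma E_cong: "(\<And>x. x \<in> cube n \<Longrightarrow> f x = g x) \<Longrightarrow> E f = E g"
  unfolding E_eq_sum by (intro sum.cong) auto

lemma E_nonneg: "(\<And>x. x \<in> cube n \<Longrightarrow> 0 \<le> f x) \<Longrightarrow> 0 \<le> E f"
  unfolding E_eq_sum by (intro sum_nonneg mult_nonneg_nonneg) auto

lemma E_has_derivative:
  assumes "\<And>x. x \<in> cube n \<Longrightarrow> ((\<lambda>t. F t x) has_real_derivative F' x) (at t)"
  shows "((\<lambda>t. E (F t)) has_real_derivative E F') (at t)"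
  unfolding E_eq_sum by (intro DERIV_sum DERIV_cmult assms)

lemma variance_eq_E: "measure_pmf.variance \<mu> f = E (\<lambda>x. (f x)\<^sup>2) - (E f)\<^sup>2"
  by (rule measure_pmf.variance_eq) auto

lemma E_power2_le: "(E f)\<^sup>2 \<le> E (\<lambda>x. (f x)\<^sup>2)"
  using variance_eq_E[of f] measure_pmf.variance_positive[of \<mu> f] by linarith

text \<open>
  Detailed balance says that under \<open>\<mu>\<close> weighted by \<open>q i\<close> the pair of \<open>x\<close> and \<open>flip i x\<close> is
  exchangeable.
\<close>

lemma E_flip_rates:
  assumes i: "i \<in> {1..n}"
  shows "E (\<lambda>x. q i x * F x (flip i x)) = E (\<lambda>x. q i x * F (flip i x) x)"
proof -
  have ff: "flip i (flip i x) = x" for x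
    by (simp add: flip_def)
  have "E (\<lambda>x. q i x * F x (flip i x))
      = (\<Sum>x\<in>cube n. pmf \<mu> (flip i x) * q i (flip i x) * F (flip i (flip i x)) (flip i x))"
    unfolding E_eq_sum using rev i ff
    by (intro sum.cong) (auto simp: reversible_def mult.assoc[symmetric])
  also have "\<dots> = (\<Sum>x\<in>cube n. pmf \<mu> x * q i x * F (flip i x) x)"
    by (rule sum.reindex_bij_witness[of _ "flip i" "flip i"])
       (use ff flip_in_cube[OF i] in auto)
  finally show ?thesis by (simp add: E_eq_sum mult.assoc)
qed

text \<open>
  Summation by parts: averaging an edge sum with its reversal turns one factor into a difference.
\<close>

lemma E_mult_generator:
  "E (\<lambda>x. g x * generator n q f x) = - (1 / 2) * (\<Sum>i=1..n. E (\<lambda>x. q i x * (D i g x * D i f x)))"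
proof -
  have one: "E (\<lambda>x. q i x * (g x * D i f x)) = - (1 / 2) * E (\<lambda>x. q i x * (D i g x * D i f x))"
    if i: "i \<in> {1..n}" for i
  proof -
    have "E (\<lambda>x. q i x * (g x * D i f x)) = E (\<lambda>x. q i x * (g (flip i x) * (f x - f (flip i x))))"
      using E_flip_rates[OF i, of "\<lambda>x y. g x * (f y - f x)"] .
    moreover have "E (\<lambda>x. q i x * (D i g x * D i f x))
        = - E (\<lambda>x. q i x * (g (flip i x) * (f x - f (flip i x)))) - E (\<lambda>x. q i x * (g x * D i f x))"
      unfolding E_eq_sum by (simp add: sum_negf[symmetric] sum_subtractf[symmetric] algebra_simps)
    ultimately show ?thesis by simp
  qed
  have "E (\<lambda>x. g x * generator n q f x) = E (\<lambda>x. \<Sum>i=1..n. q i x * (g x * D i f x))"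
    unfolding generator_def by (intro E_cong) (simp add: sum_distrib_left mult_ac)
  also have "\<dots> = (\<Sum>i=1..n. E (\<lambda>x. q i x * (g x * D i f x)))"
    by (rule Bochner_Integration.integral_sum) auto
  finally show ?thesis using one by (simp add: sum_distrib_left)
qed

lemma E_carre_du_champ:
  "E (carre_du_champ n q f) = 1 / 2 * (\<Sum>i=1..n. E (\<lambda>x. q i x * (D i f x)\<^sup>2))"
proof -
  have "E (carre_du_champ n q f) = 1 / 2 * E (\<lambda>x. \<Sum>i=1..n. q i x * (D i f x)\<^sup>2)"
    unfolding carre_du_champ_def by simp
  then show ?thesis by simp
qed

lemma E_carre_du_champ_nonneg: "0 \<le> E (carre_du_champ n q f)"
  unfolding carre_du_champ_def
  by (intro E_nonneg mult_nonneg_nonneg sum_nonneg) (auto intro: q_nonneg)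

lemma E_generator: "E (generator n q f) = 0"
  using E_mult_generator[of "\<lambda>_. 1" f] by simp

lemma E_semigroup: "E (P t f) = E f"
proof -
  have "((\<lambda>t. E (P t f)) has_real_derivative 0) (at s)" for s
    using E_has_derivative[where F = "\<lambda>t. P t f", OF semigroup_has_derivative] E_generator by simp
  then have "E (P t f) = E (P 0 f)"
    by (intro DERIV_isconst_all) auto
  then show ?thesis by (simp add: semigroup_0)
qed

lemma E_semigroup_power2_has_derivative:
  "((\<lambda>t. E (\<lambda>x. (P t f x)\<^sup>2)) has_real_derivative - 2 * E (carre_du_champ n q (P t f))) (at t)"
proof -
  have "((\<lambda>t. E (\<lambda>x. (P t f x)\<^sup>2)) has_real_derivative
      E (\<lambda>x. 2 * (P t f x * generator n q (P t f) x))) (at t)"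
    by (intro E_has_derivative) (auto intro!: derivative_eq_intros semigroup_has_derivative)
  then show ?thesis
    by (simp add: E_mult_generator E_carre_du_champ power2_eq_square)
qed

lemma E_semigroup_power2_le:
  assumes "0 \<le> t"
  shows "E (\<lambda>x. (P t f x)\<^sup>2) \<le> E (\<lambda>x. (f x)\<^sup>2)"
proof -
  have "E (\<lambda>x. (P t f x)\<^sup>2) \<le> E (\<lambda>x. (P 0 f x)\<^sup>2)"
    using E_semigroup_power2_has_derivative[of f] E_carre_du_champ_nonneg
    by (intro DERIV_nonpos_imp_nonincreasing[OF assms])
       (metis mult_minus_left neg_le_0_iff_le zero_le_mult_iff zero_le_numeral)
  then show ?thesis by (simp add: semigroup_0)
qed

text \<open>
  With \<open>h = P s g\<close> and \<open>m = min h 0\<close>, the squared negative part \<open>E m\<^sup>2\<close> has derivative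
  \<open>2 E (m L h)\<close>. By summation by parts this is minus the sum over \<open>i\<close> of the means of
  \<open>q i * D i m * D i h\<close>, which are nonnegative as \<open>m\<close> is a monotone function of \<open>h\<close>. Hence \<open>E m\<^sup>2\<close> cannot grow from its initial
  value \<open>0\<close>.
\<close>

lemma semigroup_nonneg:
  assumes g: "\<And>x. x \<in> cube n \<Longrightarrow> 0 \<le> g x" and t: "0 \<le> t" and x: "x \<in> set_pmf \<mu>"
  shows "0 \<le> P t g x"
proof -
  let ?N = "\<lambda>t. E (\<lambda>x. (min (P t g x) 0)\<^sup>2)"
  have "\<exists>d. (?N has_real_derivative d) (at s) \<and> d \<le> 0" for s
  proof (intro exI conjI)
    let ?m = "\<lambda>x. min (P s g x) 0"
    show "(?N has_real_derivative E (\<lambda>x. 2 * ?m x * generator n q (P s g) x)) (at s)"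
      by (intro E_has_derivative DERIV_chain2[OF DERIV_min_0_power2]
          semigroup_has_derivative)
    have "0 \<le> (min y 0 - min z 0) * (y - z)" for y z :: real
      by (cases "y \<le> z") (auto simp: min_def intro: mult_nonneg_nonneg mult_nonpos_nonpos)
    then have "0 \<le> E (\<lambda>x. q i x * (D i ?m x * D i (P s g) x))" if "i \<in> {1..n}" for i
      using q_nonneg[OF that] by (intro E_nonneg mult_nonneg_nonneg[of "q i _"]) auto
    then have "0 \<le> (\<Sum>i=1..n. E (\<lambda>x. q i x * (D i ?m x * D i (P s g) x)))"
      by (rule sum_nonneg)
    then show "E (\<lambda>x. 2 * ?m x * generator n q (P s g) x) \<le> 0"
      using E_mult_generator[of ?m "P s g"] by (simp add: mult.assoc)
  qed
  then have "?N t \<le> ?N 0"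
    by (intro DERIV_nonpos_imp_nonincreasing[OF t]) auto
  also have "?N 0 = E (\<lambda>x. 0)"
    using g by (intro E_cong) (simp add: semigroup_0)
  finally have "?N t \<le> 0" by simp
  then have "?N t = 0"
    by (intro antisym E_nonneg) auto
  then have "pmf \<mu> x * (min (P t g x) 0)\<^sup>2 = 0"
    unfolding E_eq_sum using x supp by (subst (asm) sum_nonneg_eq_0_iff) (auto simp: finite_cube)
  then show ?thesis using x by (auto simp: set_pmf_iff min_def split: if_splits)
qed

section \<open>Consequences of the log-Sobolev inequality\<close>

text \<open>
  This bound turns entropy into a comparison of the first two moments, and everything drawn from the
  log-Sobolev inequality passes through it. With \<open>a = E h\<^sup>2 / E h\<close>, which is the mean of \<open>h\<close> under
  the measure with density proportional to \<open>h\<close>, multiply the tangent inequality \<open>ln (h / a) \<ge> 1 - a / h\<close> by \<open>h\<^sup>2\<close>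
  and integrate: the right-hand side becomes \<open>E h\<^sup>2 - a * E h = 0\<close>.
\<close>

lemma Ent_power2_ge:
  assumes h: "\<And>x. x \<in> set_pmf \<mu> \<Longrightarrow> 0 \<le> h x" and m: "0 < E h"
  shows "E (\<lambda>x. (h x)\<^sup>2) * ln (E (\<lambda>x. (h x)\<^sup>2) / (E h)\<^sup>2) \<le> Ent \<mu> (\<lambda>x. (h x)\<^sup>2)"
proof -
  define \<phi> where "\<phi> = E (\<lambda>x. (h x)\<^sup>2)"
  define a where "a = \<phi> / E h"
  have "0 < (E h)\<^sup>2" using m by simp
  then have \<phi>: "0 < \<phi>" using E_power2_le[of h] unfolding \<phi>_def by linarith
  then have a: "0 < a" using m by (simp add: a_def)
  have pt: "2 * ln a * (h x)\<^sup>2 + 2 * (h x)\<^sup>2 - 2 * a * h x \<le> (h x)\<^sup>2 * ln ((h x)\<^sup>2)"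
    if x: "x \<in> set_pmf \<mu>" for x
  proof (cases "h x = 0")
    case False
    then have hx: "0 < h x" using h[OF x] by simp
    have "ln (a / h x) \<le> a / h x - 1" using a hx by (intro ln_le_minus_one) simp
    then have "ln a - ln (h x) \<le> a / h x - 1" using a hx by (simp add: ln_div)
    then have "(h x)\<^sup>2 * (ln a + 1 - a / h x) \<le> (h x)\<^sup>2 * ln (h x)"
      by (intro mult_left_mono) auto
    moreover have "(h x)\<^sup>2 * (a / h x) = a * h x" using hx by (simp add: power2_eq_square)
    moreover have "ln ((h x)\<^sup>2) = 2 * ln (h x)" using hx by (simp add: ln_realpow)
    ultimately show ?thesis by (simp add: algebra_simps)
  qed simp
  have "E (\<lambda>x. 2 * ln a * (h x)\<^sup>2 + 2 * (h x)\<^sup>2 - 2 * a * h x) \<le> E (\<lambda>x. (h x)\<^sup>2 * ln ((h x)\<^sup>2))"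
    using pt by (intro integral_mono_AE) (auto simp: AE_measure_pmf_iff)
  moreover have "E (\<lambda>x. 2 * ln a * (h x)\<^sup>2 + 2 * (h x)\<^sup>2 - 2 * a * h x)
      = 2 * ln a * \<phi> + 2 * \<phi> - 2 * a * E h"
    unfolding \<phi>_def by simp
  moreover have "a * E h = \<phi>" using m by (simp add: a_def)
  ultimately have "2 * ln a * \<phi> \<le> E (\<lambda>x. (h x)\<^sup>2 * ln ((h x)\<^sup>2))" by linarith
  moreover have "\<phi> * ln (\<phi> / (E h)\<^sup>2) = 2 * ln a * \<phi> - \<phi> * ln \<phi>"
    using \<phi> m by (simp add: a_def ln_div ln_realpow algebra_simps)
  ultimately show ?thesis
    unfolding Ent_def \<phi>_def[symmetric] by linarith
qed

text \<open>
  Adding a large constant to \<open>g\<close> changes neither side and makes the moment bound on the entropy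
  applicable; \<open>ln y \<ge> 1 - 1 / y\<close> then turns it into the variance. This loses a factor \<open>2\<close> against
  the optimal constant, but needs no expansion around constants and no limit.
\<close>

lemma Poincare_if_log_Sobolev:
  assumes "0 < \<rho>" and lsi: "log_Sobolev n \<mu> q \<rho>"
  shows "measure_pmf.variance \<mu> g \<le> 2 / \<rho> * E (carre_du_champ n q g)"
proof -
  define C where "C = 1 + (\<Sum>x\<in>cube n. \<bar>g x\<bar>)"
  define h where "h = (\<lambda>x. g x + C)"
  have h1: "1 \<le> h x" if "x \<in> cube n" for x
    using member_le_sum[OF that, of "\<lambda>x. \<bar>g x\<bar>"] finite_cube
    by (auto simp: h_def C_def)
  have "E (\<lambda>_. 1) \<le> E h" by (rule E_mono[OF h1])
  then have m: "0 < E h" by simp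
  define \<phi> where "\<phi> = E (\<lambda>x. (h x)\<^sup>2)"
  have \<phi>: "0 < \<phi>" using E_power2_le[of h] m zero_less_power[OF m, of 2] unfolding \<phi>_def by linarith
  have "ln ((E h)\<^sup>2 / \<phi>) \<le> (E h)\<^sup>2 / \<phi> - 1"
    using \<phi> m by (intro ln_le_minus_one) simp
  then have "1 - (E h)\<^sup>2 / \<phi> \<le> ln (\<phi> / (E h)\<^sup>2)"
    using \<phi> m by (simp add: ln_div)
  then have "\<phi> * (1 - (E h)\<^sup>2 / \<phi>) \<le> \<phi> * ln (\<phi> / (E h)\<^sup>2)"
    using \<phi> by (intro mult_left_mono) auto
  then have "\<phi> - (E h)\<^sup>2 \<le> \<phi> * ln (\<phi> / (E h)\<^sup>2)"
    using \<phi> by (simp add: right_diff_distrib)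
  also have "\<dots> \<le> Ent \<mu> (\<lambda>x. (h x)\<^sup>2)"
    unfolding \<phi>_def using h1 supp m by (intro Ent_power2_ge) force+
  also have "\<dots> \<le> 2 / \<rho> * E (carre_du_champ n q h)"
    using lsi unfolding log_Sobolev_def by blast
  also have "carre_du_champ n q h = carre_du_champ n q g"
    unfolding carre_du_champ_def h_def by simp
  finally have "\<phi> - (E h)\<^sup>2 \<le> 2 / \<rho> * E (carre_du_champ n q g)" .
  moreover have "\<phi> - (E h)\<^sup>2 = measure_pmf.variance \<mu> g"
    unfolding \<phi>_def variance_eq_E[symmetric] h_def by simp
  ultimately show ?thesis by simp
qed

text \<open>
  By the spectral gap, running the chain for a time \<open>t\<close> destroys a definite part of the variance.
\<close>

lemma semigroup_power2_loss:
  assumes \<rho>: "0 < \<rho>" and lsi: "log_Sobolev n \<mu> q \<rho>" and t: "0 \<le> t"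
  shows "(1 - exp (- \<rho> * t)) * measure_pmf.variance \<mu> f
    \<le> E (\<lambda>x. (f x)\<^sup>2) - E (\<lambda>x. (P t f x)\<^sup>2)"
proof -
  let ?V = "\<lambda>t. E (\<lambda>x. (P t f x)\<^sup>2) - (E f)\<^sup>2"
  have "exp (\<rho> * t) * ?V t \<le> exp (\<rho> * 0) * ?V 0"
  proof (rule DERIV_nonpos_imp_nonincreasing[OF t])
    fix s :: real
    let ?G = "E (carre_du_champ n q (P s f))"
    have "?V s \<le> 2 / \<rho> * ?G"
      using Poincare_if_log_Sobolev[OF \<rho> lsi, of "P s f"]
      unfolding variance_eq_E by (simp add: E_semigroup)
    then have "\<rho> * ?V s - 2 * ?G \<le> 0" using \<rho> by (simp add: field_simps)
    then have "exp (\<rho> * s) * (\<rho> * ?V s - 2 * ?G) \<le> 0"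
      by (simp add: mult_le_0_iff)
    moreover have "((\<lambda>s. exp (\<rho> * s) * ?V s) has_real_derivative
        exp (\<rho> * s) * (\<rho> * ?V s - 2 * ?G)) (at s)"
      by (auto intro!: derivative_eq_intros E_semigroup_power2_has_derivative
          simp: algebra_simps)
    ultimately show "\<exists>d. ((\<lambda>s. exp (\<rho> * s) * ?V s) has_real_derivative d) (at s) \<and> d \<le> 0"
      by blast
  qed
  then have "?V t \<le> exp (- \<rho> * t) * ?V 0"
    by (simp add: exp_minus field_simps)
  then show ?thesis
    by (simp add: semigroup_0 variance_eq_E algebra_simps)
qed

text \<open>
  This replaces hypercontractivity. Since \<open>P t g\<close> is nonnegative and keeps the mean of \<open>g\<close>, the
  moment bound and the log-Sobolev inequality give, for \<open>u t = E (P t g)\<^sup>2\<close>, the closed differential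
  inequality \<open>u' \<le> - \<rho> * u * ln (u / (E g)\<^sup>2)\<close>. In other words,
  \<open>exp (\<rho> * t) * ln (u / (E g)\<^sup>2)\<close> is nonincreasing.
\<close>

lemma ln_semigroup_power2_decay:
  assumes \<rho>: "0 < \<rho>" and lsi: "log_Sobolev n \<mu> q \<rho>" and t: "0 \<le> t"
    and g: "\<And>x. x \<in> cube n \<Longrightarrow> 0 \<le> g x" and m: "0 < E g"
  shows "ln (E (\<lambda>x. (P t g x)\<^sup>2) / (E g)\<^sup>2) \<le> exp (- \<rho> * t) * ln (E (\<lambda>x. (g x)\<^sup>2) / (E g)\<^sup>2)"
proof -
  let ?u = "\<lambda>t. E (\<lambda>x. (P t g x)\<^sup>2)"
  let ?l = "\<lambda>t. ln (?u t / (E g)\<^sup>2)"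
  have m2: "0 < (E g)\<^sup>2" using m by simp
  have u: "0 < ?u s" for s
    using E_power2_le[of "P s g"] m2 unfolding E_semigroup by linarith
  have "exp (\<rho> * t) * ?l t \<le> exp (\<rho> * 0) * ?l 0"
  proof (rule DERIV_nonpos_imp_nonincreasing[OF t])
    fix s :: real assume s: "0 \<le> s"
    let ?G = "E (carre_du_champ n q (P s g))"
    have "?u s * ?l s \<le> Ent \<mu> (\<lambda>x. (P s g x)\<^sup>2)"
      using Ent_power2_ge[of "P s g"] semigroup_nonneg[OF g s] m by (simp add: E_semigroup)
    also have "\<dots> \<le> 2 / \<rho> * ?G" using lsi unfolding log_Sobolev_def by blast
    finally have "\<rho> * ?l s - 2 * ?G / ?u s \<le> 0" using \<rho> u[of s] by (simp add: field_simps)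
    then have "exp (\<rho> * s) * (\<rho> * ?l s - 2 * ?G / ?u s) \<le> 0"
      by (simp add: mult_le_0_iff)
    moreover have "((\<lambda>s. exp (\<rho> * s) * ?l s) has_real_derivative
        exp (\<rho> * s) * (\<rho> * ?l s - 2 * ?G / ?u s)) (at s)"
      using u[of s] m m2
      by (auto intro!: derivative_eq_intros E_semigroup_power2_has_derivative
          simp: field_simps)
    ultimately show "\<exists>d. ((\<lambda>s. exp (\<rho> * s) * ?l s) has_real_derivative d) (at s) \<and> d \<le> 0"
      by blast
  qed
  then show ?thesis
    by (simp add: semigroup_0 exp_minus field_simps)
qed

text \<open>
  The gap condition \<open>b * g \<le> g\<^sup>2\<close> says that \<open>g\<close> is \<open>0\<close> or at least \<open>b\<close>, so its mean is at most
  \<open>I / b\<close> with \<open>I = E g\<^sup>2\<close>. Hence the limit value \<open>(E g)\<^sup>2\<close> of the second moment is of order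
  \<open>I\<^sup>2\<close>, far below its initial value \<open>I\<close>, and the preceding decay interpolates geometrically
  between the two: with \<open>s = exp (- \<rho> * t)\<close>, the second moment at time \<open>t\<close> is at most
  \<open>I / b\<^sup>2\<close> times \<open>I\<close> to the power \<open>1 - s\<close>.
\<close>

lemma semigroup_power2_gap_decay:
  assumes \<rho>: "0 < \<rho>" and lsi: "log_Sobolev n \<mu> q \<rho>" and t: "0 \<le> t" "\<rho> * t \<le> 1"
    and g: "\<And>x. x \<in> cube n \<Longrightarrow> 0 \<le> g x" and b: "0 < b" "b \<le> 1"
    and gb: "\<And>x. x \<in> cube n \<Longrightarrow> b * g x \<le> (g x)\<^sup>2"
    and M: "E (\<lambda>x. (g x)\<^sup>2) \<le> exp (- \<theta>)" and \<theta>: "0 \<le> \<theta>"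
  shows "E (\<lambda>x. (P t g x)\<^sup>2) \<le> E (\<lambda>x. (g x)\<^sup>2) / b\<^sup>2 * exp (- (\<theta> * \<rho> / 2) * t)"
proof -
  define I where "I = E (\<lambda>x. (g x)\<^sup>2)"
  define u where "u = E (\<lambda>x. (P t g x)\<^sup>2)"
  have uI: "u \<le> I" using E_semigroup_power2_le[OF t(1)] by (simp add: u_def I_def)
  have I0: "0 \<le> I" unfolding I_def by (intro E_nonneg) auto
  show ?thesis
  proof (cases "E g = 0")
    case True
    then have "\<forall>x\<in>cube n. pmf \<mu> x * g x = 0"
      unfolding E_eq_sum by (subst (asm) sum_nonneg_eq_0_iff) (auto simp: finite_cube g)
    then have "I = 0" unfolding I_def E_eq_sum by (intro sum.neutral) auto
    then show ?thesis using uI by (simp add: I_def u_def)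
  next
    case False
    then have m: "0 < E g" using E_nonneg[of g] g by (simp add: order_less_le)
    then have m2: "0 < (E g)\<^sup>2" by simp
    have u: "0 < u" using E_power2_le[of "P t g"] m2 unfolding E_semigroup u_def by linarith
    then have I: "0 < I" using uI by linarith
    have "b * E g \<le> I" using E_mono[of "\<lambda>x. b * g x" "\<lambda>x. (g x)\<^sup>2"] gb by (simp add: I_def)
    then have "E g \<le> I / b" using b by (simp add: field_simps)
    then have "ln (E g) \<le> ln (I / b)" using m I b by (subst ln_le_cancel_iff) auto
    then have lm: "ln (E g) \<le> ln I - ln b" using I b by (simp add: ln_div)
    have lI: "ln I \<le> - \<theta>" using M I by (metis I_def ln_exp ln_le_cancel_iff exp_gt_zero)
    have lb: "ln b \<le> 0" using b by simp
    define s where "s = exp (- \<rho> * t)"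
    have s: "0 \<le> 1 - s" "1 - s \<le> 1" "\<rho> * t / 2 \<le> 1 - s"
      using one_minus_exp_ge_half[of "\<rho> * t"] \<rho> t by (auto simp: s_def)
    have "ln u - 2 * ln (E g) \<le> s * (ln I - 2 * ln (E g))"
      using ln_semigroup_power2_decay[OF \<rho> lsi t(1) g m] u I m
      by (simp add: u_def[symmetric] I_def[symmetric] ln_div ln_realpow s_def)
    then have "ln u \<le> ln I - (1 - s) * ln I + 2 * ((1 - s) * ln (E g))"
      by (simp add: algebra_simps)
    also have "\<dots> \<le> ln I - (1 - s) * ln I + 2 * ((1 - s) * (ln I - ln b))"
      using mult_left_mono[OF lm s(1)] by linarith
    also have "\<dots> = ln I + (1 - s) * ln I + 2 * ((1 - s) * - ln b)"
      by (simp add: algebra_simps)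
    also have "\<dots> \<le> ln I + (1 - s) * - \<theta> + 2 * (1 * - ln b)"
      using s(1,2) lI lb by (intro add_mono mult_left_mono mult_right_mono) auto
    also have "\<dots> \<le> ln I - \<rho> * t / 2 * \<theta> - 2 * ln b"
      using mult_right_mono[OF s(3) \<theta>] by simp
    also have "\<dots> = ln (I / b\<^sup>2 * exp (- (\<theta> * \<rho> / 2) * t))"
      using I b by (simp add: ln_mult ln_div ln_realpow)
    finally have "u \<le> I / b\<^sup>2 * exp (- (\<theta> * \<rho> / 2) * t)"
      using u I b by (subst (asm) ln_le_cancel_iff) auto
    then show ?thesis by (simp add: u_def I_def)
  qed
qed

section \<open>Influences of Boolean functions\<close>

lemma influence_nonneg: "0 \<le> influence \<mu> q w i f"
  unfolding influence_def by (intro E_nonneg) auto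

lemma total_influence_ge:
  assumes "0 < b" and w: "bounded_family n b w"
  shows "b * E (carre_du_champ n q f) \<le> total_influence n \<mu> q w f"
proof -
  have "b * E (carre_du_champ n q f) = (\<Sum>i=1..n. E (\<lambda>x. b * (1 / 2 * (q i x * (D i f x)\<^sup>2))))"
    unfolding E_carre_du_champ by (simp add: sum_distrib_left)
  also have "\<dots> \<le> (\<Sum>i=1..n. influence \<mu> q w i f)"
    unfolding influence_def
  proof (intro sum_mono E_mono)
    fix i x assume ix: "i \<in> {1..n}" "x \<in> cube n"
    have wb: "b \<le> w i x" using w ix by (simp add: bounded_family_def)
    have "b * (1 / 2 * (q i x * (D i f x)\<^sup>2)) \<le> w i x * (1 / 2 * (q i x * (D i f x)\<^sup>2))"
      using wb q_nonneg[OF ix] by (intro mult_right_mono) auto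
    also have "\<dots> = (wderiv q w i f x)\<^sup>2"
      using wb assms(1) q_nonneg[OF ix] by (simp add: wderiv_def power_mult_distrib)
    finally show "b * (1 / 2 * (q i x * (D i f x)\<^sup>2)) \<le> (wderiv q w i f x)\<^sup>2" .
  qed
  finally show ?thesis by (simp add: total_influence_def)
qed

text \<open>
  The commutation of gradient and semigroup, squared and integrated. It trades the gradient of
  \<open>P t f\<close>, about which nothing is known, for the semigroup acting on the gradient of \<open>f\<close>.
\<close>

lemma total_influence_semigroup_le:
  assumes csge: "zero_CSGE n q w \<rho>\<^sub>C" and \<kappa>: "\<kappa> = max (- \<rho>\<^sub>C) 0" and t: "0 \<le> t"
  shows "total_influence n \<mu> q w (P t f)
    \<le> exp (2 * \<kappa> * t) * (\<Sum>i=1..n. E (\<lambda>x. (P t (\<lambda>y. \<bar>wderiv q w i f y\<bar>) x)\<^sup>2))"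
proof -
  let ?g = "\<lambda>i y. \<bar>wderiv q w i f y\<bar>"
  have "total_influence n \<mu> q w (P t f) = E (\<lambda>x. \<Sum>i=1..n. (wderiv q w i (P t f) x)\<^sup>2)"
    unfolding total_influence_def influence_def by simp
  also have "\<dots> \<le> E (\<lambda>x. exp (2 * \<kappa> * t) * (\<Sum>i=1..n. (P t (?g i) x)\<^sup>2))"
  proof (rule E_mono)
    fix x assume x: "x \<in> cube n"
    let ?R = "L2_set (\<lambda>i. P t (?g i) x) {1..n}"
    have "L2_set (\<lambda>i. wderiv q w i (P t f) x) {1..n} \<le> exp (- \<rho>\<^sub>C * t) * ?R"
      using csge t x unfolding zero_CSGE_def by blast
    also have "\<dots> \<le> exp (\<kappa> * t) * ?R"
      using mult_right_mono[of "- \<rho>\<^sub>C" \<kappa> t] t \<kappa> by (intro mult_right_mono) auto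
    finally have "(L2_set (\<lambda>i. wderiv q w i (P t f) x) {1..n})\<^sup>2 \<le> (exp (\<kappa> * t) * ?R)\<^sup>2"
      by (intro power_mono) auto
    moreover have "(exp (\<kappa> * t))\<^sup>2 = exp (2 * \<kappa> * t)"
      by (simp add: power2_eq_square exp_add[symmetric])
    ultimately show "(\<Sum>i=1..n. (wderiv q w i (P t f) x)\<^sup>2)
        \<le> exp (2 * \<kappa> * t) * (\<Sum>i=1..n. (P t (?g i) x)\<^sup>2)"
      by (simp add: power_mult_distrib L2_set_def sum_nonneg)
  qed
  also have "\<dots> = exp (2 * \<kappa> * t) * (\<Sum>i=1..n. E (\<lambda>x. (P t (?g i) x)\<^sup>2))"
    by simp
  finally show ?thesis .
qed

text \<open>
  A nonzero increment of \<open>f\<close> has size \<open>2\<close>, and the weight in front of it is bounded below. Through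
  this gap the decay estimate uses that \<open>f\<close> is Boolean.
\<close>

lemma wderiv_Boolean_gap:
  assumes b: "0 < b" and q: "bounded_family n b q" and w: "bounded_family n b w"
    and f: "f \<in> cube n \<rightarrow> {-1, 1}" and i: "i \<in> {1..n}" and x: "x \<in> cube n"
  shows "b * \<bar>wderiv q w i f x\<bar> \<le> (wderiv q w i f x)\<^sup>2"
proof (cases "f (flip i x) = f x")
  case False
  have "f x \<in> {-1, 1}" "f (flip i x) \<in> {-1, 1}" using f flip_in_cube[OF i x] x by auto
  then have 2: "\<bar>f (flip i x) - f x\<bar> = 2" using False by auto
  have "b \<le> w i x" "b \<le> q i x" using q w i x by (auto simp: bounded_family_def)
  then have "b * b \<le> w i x * q i x" using b by (intro mult_mono) auto
  moreover have "0 \<le> b * b" by simp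
  ultimately have "b * b \<le> 2 * (w i x * q i x)" by linarith
  then have "(b / 2)\<^sup>2 \<le> 1 / 2 * w i x * q i x"
    by (simp add: power2_eq_square)
  then have "b / 2 \<le> sqrt (1 / 2 * w i x * q i x)" by (rule real_le_rsqrt)
  then have "b \<le> \<bar>wderiv q w i f x\<bar>"
    using 2 by (simp add: wderiv_def abs_mult)
  then have "b * \<bar>wderiv q w i f x\<bar> \<le> \<bar>wderiv q w i f x\<bar> * \<bar>wderiv q w i f x\<bar>"
    by (intro mult_right_mono) auto
  then show ?thesis by (simp add: power2_eq_square)
qed (simp add: wderiv_def)

lemma influence_le_max_influence:
  "i \<in> {1..n} \<Longrightarrow> influence \<mu> q w i f \<le> max_influence n \<mu> q w f"
  unfolding max_influence_def by (intro Max_ge) auto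

lemma max_influence_nonneg: "1 \<le> n \<Longrightarrow> 0 \<le> max_influence n \<mu> q w f"
  using influence_le_max_influence[of 1 w f] influence_nonneg[of w 1 f] by simp

lemma total_influence_le: "total_influence n \<mu> q w f \<le> real n * max_influence n \<mu> q w f"
  unfolding total_influence_def
  using sum_mono[of "{1..n}" "\<lambda>i. influence \<mu> q w i f" "\<lambda>_. max_influence n \<mu> q w f"]
    influence_le_max_influence[of _ w f] by simp

lemma total_influence_nonneg: "0 \<le> total_influence n \<mu> q w f"
  unfolding total_influence_def by (intro sum_nonneg influence_nonneg)

text \<open>
  Put \<open>\<theta> = ln (1 / M)\<close>; the bound is trivial unless \<open>\<theta> > 0\<close>, as influences are nonnegative. Up to the time \<open>T = 1 / (\<rho> + \<kappa>)\<close> the commutation costs at most the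
  factor \<open>exp 2\<close>, and the dissipation at time \<open>t\<close> is bounded by a multiple of
  \<open>I * exp (- (\<theta> * \<rho> / 2) * t)\<close>. Its time integral is at most a multiple of \<open>I / (\<theta> * \<rho>)\<close>, whereas
  the spectral gap forces a loss of at least \<open>\<rho> * T / 2\<close> times the variance.
\<close>

lemma Talagrand_influence_bound:
  assumes n: "1 \<le> n" and b: "0 < b" "b \<le> 1"
    and q: "bounded_family n b q" and w: "bounded_family n b w"
    and csge: "zero_CSGE n q w \<rho>\<^sub>C" and \<kappa>: "\<kappa> = max (- \<rho>\<^sub>C) 0"
    and \<rho>: "0 < \<rho>" and lsi: "log_Sobolev n \<mu> q \<rho>"
    and f: "f \<in> cube n \<rightarrow> {-1, 1}"
  shows "b ^ 3 / (8 * exp 2) * (\<rho>\<^sup>2 / (\<rho> + \<kappa>)) * ln (1 / max_influence n \<mu> q w f)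
    * measure_pmf.variance \<mu> f \<le> total_influence n \<mu> q w f"
proof -
  define M where "M = max_influence n \<mu> q w f"
  define \<theta> where "\<theta> = ln (1 / M)"
  define V where "V = measure_pmf.variance \<mu> f"
  define I where "I = total_influence n \<mu> q w f"
  have \<kappa>0: "0 \<le> \<kappa>" using \<kappa> by simp
  have V0: "0 \<le> V" unfolding V_def by (rule measure_pmf.variance_positive)
  have I0: "0 \<le> I" unfolding I_def by (rule total_influence_nonneg)
  have "b ^ 3 / (8 * exp 2) * (\<rho>\<^sup>2 / (\<rho> + \<kappa>)) * \<theta> * V \<le> I"
  proof (cases "0 < \<theta>")
    case False
    then have "b ^ 3 / (8 * exp 2) * (\<rho>\<^sup>2 / (\<rho> + \<kappa>)) * V * \<theta> \<le> 0"
      using V0 b \<rho> \<kappa>0 by (intro mult_nonneg_nonpos) auto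
    then show ?thesis using I0 by (simp add: mult_ac)
  next
    case True
    have M0: "0 \<le> M" unfolding M_def by (rule max_influence_nonneg[OF n])
    have "M \<noteq> 0" using True by (auto simp: \<theta>_def)
    then have "0 < M" using M0 by simp
    then have M: "M = exp (- \<theta>)" by (simp add: \<theta>_def ln_div)
    define T where "T = 1 / (\<rho> + \<kappa>)"
    have T: "0 \<le> T" "\<rho> * T \<le> 1" "\<kappa> * T \<le> 1"
      using \<rho> \<kappa>0 by (auto simp: T_def field_simps)
    let ?u = "\<lambda>t. E (\<lambda>x. (P t f x)\<^sup>2)"
    define a where "a = \<theta> * \<rho> / 2"
    define C where "C = 2 * exp 2 * I / b ^ 3"
    have a: "0 < a" using True \<rho> by (simp add: a_def)
    have C: "0 \<le> C" using I0 b by (simp add: C_def)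
    have dissip: "2 * E (carre_du_champ n q (P t f)) \<le> C * exp (- a * t)" if t: "0 \<le> t" "t \<le> T" for t
    proof -
      have \<rho>t: "\<rho> * t \<le> 1" using T(2) mult_left_mono[OF t(2), of \<rho>] \<rho> by linarith
      have \<kappa>t: "\<kappa> * t \<le> 1" using T(3) mult_left_mono[OF t(2), of \<kappa>] \<kappa>0 by linarith
      have "E (\<lambda>x. (P t (\<lambda>y. \<bar>wderiv q w i f y\<bar>) x)\<^sup>2) \<le> influence \<mu> q w i f / b\<^sup>2 * exp (- a * t)"
        if i: "i \<in> {1..n}" for i
        using semigroup_power2_gap_decay[OF \<rho> lsi t(1) \<rho>t _ b,
            of "\<lambda>y. \<bar>wderiv q w i f y\<bar>" \<theta>] wderiv_Boolean_gap[OF b(1) q w f i]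
          influence_le_max_influence[OF i, of w f] True
        by (simp add: influence_def[symmetric] a_def M_def[symmetric] M)
      then have "(\<Sum>i=1..n. E (\<lambda>x. (P t (\<lambda>y. \<bar>wderiv q w i f y\<bar>) x)\<^sup>2)) \<le> I / b\<^sup>2 * exp (- a * t)"
        unfolding I_def total_influence_def sum_divide_distrib sum_distrib_right by (rule sum_mono)
      then have "exp (2 * \<kappa> * t) * (\<Sum>i=1..n. E (\<lambda>x. (P t (\<lambda>y. \<bar>wderiv q w i f y\<bar>) x)\<^sup>2))
          \<le> exp 2 * (I / b\<^sup>2 * exp (- a * t))"
        using \<kappa>t by (intro mult_mono sum_nonneg E_nonneg) auto
      then have "b * E (carre_du_champ n q (P t f)) \<le> exp 2 * (I / b\<^sup>2 * exp (- a * t))"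
        using total_influence_semigroup_le[OF csge \<kappa> t(1), of f]
          total_influence_ge[OF b(1) w, of "P t f"] by linarith
      then show ?thesis using b by (simp add: C_def field_simps power3_eq_cube power2_eq_square)
    qed
    \<comment> \<open>This is the integrated form of \<open>dissip\<close>: \<open>C / a * exp (- a * t)\<close> is minus a primitive of
      the bound there.\<close>
    have "C / a * exp (- a * T) - ?u T \<le> C / a * exp (- a * 0) - ?u 0"
    proof (rule DERIV_nonpos_imp_nonincreasing[OF T(1)])
      fix t assume t: "0 \<le> t" "t \<le> T"
      have "((\<lambda>t. C / a * exp (- a * t) - ?u t) has_real_derivative
          2 * E (carre_du_champ n q (P t f)) - C * exp (- a * t)) (at t)"
        using a by (auto intro!: derivative_eq_intros E_semigroup_power2_has_derivative)
      then show "\<exists>d. ((\<lambda>t. C / a * exp (- a * t) - ?u t) has_real_derivative d) (at t) \<and> d \<le> 0"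
        using dissip[OF t] by (intro exI conjI) auto
    qed
    moreover have "0 \<le> C / a * exp (- a * T)" using a C by simp
    ultimately have "?u 0 - ?u T \<le> C / a" by simp
    moreover have "(1 - exp (- \<rho> * T)) * V \<le> ?u 0 - ?u T"
      using semigroup_power2_loss[OF \<rho> lsi T(1), of f] by (simp add: V_def semigroup_0)
    moreover have "\<rho> * T / 2 * V \<le> (1 - exp (- \<rho> * T)) * V"
      using one_minus_exp_ge_half[of "\<rho> * T"] T \<rho> V0 by (intro mult_right_mono) auto
    ultimately have "\<rho> * T / 2 * V \<le> C / a" by linarith
    then have "\<rho> * T / 2 * V * (a * b ^ 3 / (2 * exp 2)) \<le> C / a * (a * b ^ 3 / (2 * exp 2))"
      using a b by (intro mult_right_mono) auto
    also have "\<dots> = I" using a b by (simp add: C_def)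
    finally have "\<rho> * T / 2 * V * (a * b ^ 3 / (2 * exp 2)) \<le> I" .
    moreover have "\<rho>\<^sup>2 / (\<rho> + \<kappa>) = \<rho>\<^sup>2 * T" by (simp add: T_def)
    ultimately show ?thesis by (simp add: a_def power2_eq_square mult_ac)
  qed
  then show ?thesis by (simp add: M_def \<theta>_def V_def I_def)
qed

lemma variance_Boolean_le_1:
  fixes f :: "point \<Rightarrow> real"
  assumes f: "f \<in> cube n \<rightarrow> {-1, 1}"
  shows "measure_pmf.variance \<mu> f \<le> 1"
proof -
  have "E (\<lambda>x. (f x)\<^sup>2) = E (\<lambda>_. 1)"
    using f by (intro E_cong) (force simp: Pi_iff power2_eq_1_iff)
  then show ?thesis by (simp add: variance_eq_E)
qed

text \<open>
  The case \<open>M = 0\<close> must be treated apart, as \<open>ln (1 / 0)\<close> is \<open>0\<close> and the logarithmic bound then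
  says nothing.
\<close>

lemma variance_eq_0_if_max_influence_eq_0:
  assumes "0 < b" "bounded_family n b w" "0 < \<rho>" "log_Sobolev n \<mu> q \<rho>"
    and M: "max_influence n \<mu> q w f = 0"
  shows "measure_pmf.variance \<mu> f = 0"
proof -
  have "b * E (carre_du_champ n q f) \<le> 0"
    using total_influence_ge[OF assms(1,2), of f] total_influence_le[of w f] M by simp
  then have "E (carre_du_champ n q f) = 0"
    using assms(1) E_carre_du_champ_nonneg[of f] by (simp add: mult_le_0_iff)
  then show ?thesis
    using Poincare_if_log_Sobolev[OF assms(3,4), of f] measure_pmf.variance_positive[of \<mu> f] by simp
qed

end

theorem corollary5p6:
  fixes b :: real
  assumes "0 < b" and "b \<le> 1"
  shows "\<exists>c::real. c > 0 \<and>
    (\<forall>(n::nat) (\<mu> :: point pmf) (q :: nat \<Rightarrow> point \<Rightarrow> real) (w :: nat \<Rightarrow> point \<Rightarrow> real)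
      (\<rho>\<^sub>C :: real) (\<rho>\<^sub>L :: real) (\<kappa> :: real).
      n \<ge> 1 \<longrightarrow>
      set_pmf \<mu> \<subseteq> cube n \<longrightarrow>
      nonneg_family n q \<longrightarrow> nonneg_family n w \<longrightarrow>
      reversible n \<mu> q \<longrightarrow>
      zero_CSGE n q w \<rho>\<^sub>C \<longrightarrow>
      \<rho>\<^sub>L > 0 \<longrightarrow> log_Sobolev n \<mu> q \<rho>\<^sub>L \<longrightarrow>
      bounded_family n b q \<longrightarrow> bounded_family n b w \<longrightarrow>
      \<kappa> = max (- \<rho>\<^sub>C) 0 \<longrightarrow>
      (\<forall>f :: point \<Rightarrow> real. f \<in> cube n \<rightarrow> {-1, 1} \<longrightarrow>
        total_influence n \<mu> q w f
          \<ge> c * (\<rho>\<^sub>L\<^sup>2 / (\<rho>\<^sub>L + \<kappa>)) * ln (1 / max_influence n \<mu> q w f)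
              * measure_pmf.variance \<mu> f \<and>
        max_influence n \<mu> q w f
          \<ge> c * (\<rho>\<^sub>L\<^sup>2 / ((\<rho>\<^sub>L + \<kappa>) * real n)) * ln ((\<rho>\<^sub>L + \<kappa>) * real n / \<rho>\<^sub>L\<^sup>2)
              * measure_pmf.variance \<mu> f))"
proof -
  \<comment> \<open>Half of the constant in the bound on the total influence: the passage to the maximal influence
    costs a factor \<open>2\<close>.\<close>
  define c where "c = b ^ 3 / (16 * exp 2)"
  have "b ^ 3 \<le> 1" using assms by (simp add: power_le_one)
  also have "1 \<le> 8 * exp (2::real)" using one_le_exp_iff[of "2::real"] by linarith
  finally have "b ^ 3 \<le> 8 * exp 2" .
  then have c: "0 < c" "2 * c \<le> 1" and c2: "2 * c = b ^ 3 / (8 * exp 2)"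
    using assms by (auto simp: c_def field_simps)
  show ?thesis
  proof (intro exI[of _ c] conjI allI impI)
    show "0 < c" by (rule c)
  next
    fix n :: nat and \<mu> :: "point pmf" and q w :: "nat \<Rightarrow> point \<Rightarrow> real"
      and \<rho>\<^sub>C \<rho>\<^sub>L \<kappa> :: real and f :: "point \<Rightarrow> real"
    assume n: "1 \<le> n" and supp: "set_pmf \<mu> \<subseteq> cube n" and q0: "nonneg_family n q"
      and rev: "reversible n \<mu> q" and csge: "zero_CSGE n q w \<rho>\<^sub>C"
      and \<rho>: "0 < \<rho>\<^sub>L" and lsi: "log_Sobolev n \<mu> q \<rho>\<^sub>L"
      and q: "bounded_family n b q" and w: "bounded_family n b w"
      and \<kappa>: "\<kappa> = max (- \<rho>\<^sub>C) 0" and f: "f \<in> cube n \<rightarrow> {-1, 1}"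
    interpret reversible_chain n \<mu> q by unfold_locales fact+
    define V where "V = measure_pmf.variance \<mu> f"
    define M where "M = max_influence n \<mu> q w f"
    define A where "A = \<rho>\<^sub>L\<^sup>2 / (\<rho>\<^sub>L + \<kappa>)"
    have A: "0 < A" using \<rho> \<kappa> by (simp add: A_def)
    have V: "0 \<le> V" "V \<le> 1"
      using variance_Boolean_le_1[OF f] measure_pmf.variance_positive[of \<mu> f] by (auto simp: V_def)
    have M0: "0 \<le> M" unfolding M_def by (rule max_influence_nonneg[OF n])
    have *: "2 * c * A * ln (1 / M) * V \<le> total_influence n \<mu> q w f"
      using Talagrand_influence_bound[OF n assms q w csge \<kappa> \<rho> lsi f]
      by (simp only: c2 A_def M_def V_def)
    have "c * A * ln (1 / M) * V \<le> total_influence n \<mu> q w f"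
      using * total_influence_nonneg[of w f] by (cases "0 \<le> c * A * ln (1 / M) * V") auto
    then show "c * (\<rho>\<^sub>L\<^sup>2 / (\<rho>\<^sub>L + \<kappa>)) * ln (1 / max_influence n \<mu> q w f)
        * measure_pmf.variance \<mu> f \<le> total_influence n \<mu> q w f"
      by (simp only: A_def M_def V_def)
    have "c * (A / real n) * ln (1 / (A / real n)) * V \<le> M"
    proof (cases "M = 0")
      case True
      then have "V = 0"
        using variance_eq_0_if_max_influence_eq_0[OF assms(1) w \<rho> lsi, of f] by (simp add: M_def V_def)
      then show ?thesis using True by simp
    next
      case False
      have "2 * c * A * ln (1 / M) * V \<le> real n * M"
        using * total_influence_le[of w f] by (simp only: M_def)
      then have "2 * c * (A / real n) * ln (1 / M) * V \<le> M"
        using n by (simp add: field_simps)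
      from bootstrap_max_influence[OF _ c(2) _ V _ this] show ?thesis
        using c A n M0 False by simp
    qed
    then show "c * (\<rho>\<^sub>L\<^sup>2 / ((\<rho>\<^sub>L + \<kappa>) * real n)) * ln ((\<rho>\<^sub>L + \<kappa>) * real n / \<rho>\<^sub>L\<^sup>2)
        * measure_pmf.variance \<mu> f \<le> max_influence n \<mu> q w f"
      by (simp add: A_def M_def V_def mult.commute)
  qed
qed

end
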